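(* Let $\phi\in\mathrm{SCL}(M)$ and $d\geqslant2$. For any distinct $a,b\in M$ there exists a piecewise smooth curve (in local charts, a broken line) $\gamma:[0,1]\to M$ with $\gamma(0)=a$, $\gamma(1)=b$ and $\gamma(s)\notin\Sigma^{\geqslant2}(\phi)$ for all $s\in(0,1)$.
   Context: $M$ is a compact connected smooth manifold without boundary of dimension $d$. $\phi\in\mathrm{SCL}(M)$ means $\phi$ is semiconcave with linear modulus: $\phi=\inf_i\phi_i$ for a family of $C^2$ functions with uniformly upper-bounded Hessians; equivalently in local coordinates there is $C\geqslant0$ such that for each $x$ there is $p$ with $\phi(y)\leqslant\phi(x)+\langle p,y-x\rangle+\frac C2|y-x|^2$ for all nearby $y$. $D^+\phi(x)$ is the set of such $p$, $\dim D^+\phi(x)$ the dimension of its affine hull, and $\Sigma^{\geqslant2}(\phi)=\{x\in M:\dim D^+\phi(x)\geqslant2\}$. *)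

theory Defs
  imports "HOL-Analysis.Analysis"
begin

definition smooth_on :: "'a::euclidean_space set \<Rightarrow> ('a \<Rightarrow> 'b::real_normed_vector) \<Rightarrow> bool" where
  "smooth_on S f \<longleftrightarrow> (\<exists>F. f \<in> F \<and>
     (\<forall>g\<in>F. continuous_on S g \<and>
        (\<forall>i\<in>Basis. \<exists>g'\<in>F. \<forall>x\<in>S.
           ((\<lambda>t. g (x + t *\<^sub>R i)) has_vector_derivative g' x) (at 0))))"

definition smooth_atlas :: "('a::topological_space set \<times> ('a \<Rightarrow> real^'n)) set \<Rightarrow> bool" where
  "smooth_atlas A \<longleftrightarrow>
     \<Union>(fst ` A) = UNIV \<and>
     (\<forall>(U,\<psi>)\<in>A. open U \<and> open (\<psi> ` U) \<and> (\<exists>g. homeomorphism U (\<psi> ` U) \<psi> g)) \<and>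
     (\<forall>(U,\<psi>)\<in>A. \<forall>(V,\<theta>)\<in>A. smooth_on (\<psi> ` (U \<inter> V)) (\<theta> \<circ> inv_into U \<psi>))"

definition loc_semiconcave_lin :: "(real^'n) set \<Rightarrow> (real^'n \<Rightarrow> real) \<Rightarrow> bool" where
  "loc_semiconcave_lin S u \<longleftrightarrow>
     (\<forall>z\<in>S. \<exists>r>0. \<exists>C\<ge>0. ball z r \<subseteq> S \<and>
        (\<forall>x\<in>ball z r. \<exists>p. \<forall>y\<in>ball z r.
            u y \<le> u x + p \<bullet> (y - x) + C / 2 * (norm (y - x))\<^sup>2))"

definition SCL :: "('a::topological_space set \<times> ('a \<Rightarrow> real^'n)) set \<Rightarrow> ('a \<Rightarrow> real) \<Rightarrow> bool" where
  "SCL A \<phi> \<longleftrightarrow> (\<forall>(U,\<psi>)\<in>A. loc_semiconcave_lin (\<psi> ` U) (\<phi> \<circ> inv_into U \<psi>))"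

definition superdiff :: "(real^'n) set \<Rightarrow> (real^'n \<Rightarrow> real) \<Rightarrow> real^'n \<Rightarrow> (real^'n) set" where
  "superdiff S u x = {p. \<forall>e>0. \<exists>d>0. \<forall>y\<in>S. norm (y - x) < d \<longrightarrow>
       u y - u x - p \<bullet> (y - x) \<le> e * norm (y - x)}"

definition Sigma_ge2 :: "('a::topological_space set \<times> ('a \<Rightarrow> real^'n)) set \<Rightarrow> ('a \<Rightarrow> real) \<Rightarrow> 'a set" where
  "Sigma_ge2 A \<phi> = {x. \<exists>(U,\<psi>)\<in>A. x \<in> U \<and>
       aff_dim (superdiff (\<psi> ` U) (\<phi> \<circ> inv_into U \<psi>) (\<psi> x)) \<ge> 2}"

definition broken_line :: "('a::topological_space set \<times> ('a \<Rightarrow> real^'n)) set \<Rightarrow> (real \<Rightarrow> 'a) \<Rightarrow> bool" where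
  "broken_line A \<gamma> \<longleftrightarrow> continuous_on {0..1} \<gamma> \<and>
     (\<exists>k::nat. \<exists>t::nat \<Rightarrow> real. k \<ge> 1 \<and> t 0 = 0 \<and> t k = 1 \<and> (\<forall>i<k. t i < t (Suc i)) \<and>
        (\<forall>i<k. \<exists>(U,\<psi>)\<in>A. \<gamma> ` {t i..t (Suc i)} \<subseteq> U \<and>
           (\<forall>s\<in>{t i..t (Suc i)}. \<psi> (\<gamma> s) = \<psi> (\<gamma> (t i)) +
               ((s - t i) / (t (Suc i) - t i)) *\<^sub>R (\<psi> (\<gamma> (t (Suc i))) - \<psi> (\<gamma> (t i))))))"

end

theory Submission
  imports Defs
begin

text \<open>
  In a chart ball where the semiconcavity constant is \<open>C\<close>, the superdifferential satisfies
  \<open>(p - q) \<bullet> (x - y) \<le> C |x - y|\<^sup>2\<close>, so the point \<open>x\<close> is a 1-Lipschitz function \<open>J\<close> of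
  \<open>(C + 1) x - p\<close>. If \<open>D\<^sup>+\<phi>(x)\<close> has dimension at least 2, then \<open>x\<close> is the image of a
  two-dimensional convex set, which meets one of the countably many codimension 2 coordinate
  planes with rational offsets. Hence the singular set is a countable union of Lipschitz images of
  subsets of \<open>(n - 2)\<close>-planes, and the cone over it from any apex is a countable union of locally
  Lipschitz images of subsets of hyperplanes, thus a null set. So two points of the ball are joined,
  off the singular set, by two segments through a generic third point. As the transition
  maps are differentiable, the singular set does not depend on the chart; connectedness of \<open>M\<close>
  then concludes, with local paths glued at non-singular points, which are dense.
\<close>

section \<open>Cones over the singular set in Euclidean space\<close>

text \<open>Along a segment, semiconcavity makes \<open>u\<close> minus a quadratic concave, so a
  first-order upper bound at \<open>x\<close> extends to the whole ball with the same
  \<open>C\<close>. This turns the infinitesimal condition in \<open>superdiff\<close> into an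
  inequality between any two points of the ball.\<close>

lemma superdiff_quadratic_bound:
  fixes u :: "real^'n \<Rightarrow> real"
  assumes sub: "ball z r \<subseteq> S" and "C \<ge> 0"
    and sc: "\<And>x. x \<in> ball z r \<Longrightarrow> \<exists>p. \<forall>y\<in>ball z r.
            u y \<le> u x + p \<bullet> (y - x) + C / 2 * (norm (y - x))\<^sup>2"
    and x: "x \<in> ball z r" and y: "y \<in> ball z r" and p: "p \<in> superdiff S u x"
  shows "u y \<le> u x + p \<bullet> (y - x) + C / 2 * (norm (y - x))\<^sup>2"
proof (cases "y = x")
  case False
  define h where "h = y - x"
  define N where "N = norm h"
  have N: "N > 0" using False by (simp add: N_def h_def)
  show ?thesis
  proof (rule field_le_epsilon)
    fix e :: real assume "e > 0"
    then have "e / N > 0" using N by simp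
    then obtain d where d: "d > 0"
      "\<And>w. w \<in> S \<Longrightarrow> norm (w - x) < d \<Longrightarrow> u w - u x - p \<bullet> (w - x) \<le> e / N * norm (w - x)"
      using p unfolding superdiff_def by blast
    \<comment> \<open>The test point \<open>w\<close> lies on the segment from \<open>x\<close> to
      \<open>y\<close>, close enough to \<open>x\<close> for the superdifferential inequality with
      error \<open>e / N\<close> to apply.\<close>
    define t where "t = min 1 (d / (2 * N))"
    have t: "0 < t" "t \<le> 1" "t * N < d"
      using d(1) N by (auto simp: t_def min_def field_simps)
    define w where "w = x + t *\<^sub>R h"
    have wb: "w \<in> ball z r"
    proof -
      have "w = (1 - t) *\<^sub>R x + t *\<^sub>R y" by (simp add: w_def h_def algebra_simps)
      then show ?thesis using convexD_alt[OF convex_ball x y, of t] t by simp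
    qed
    have nw: "norm (w - x) = t * N" using t by (simp add: w_def N_def)
    have A: "u w - u x - t * (p \<bullet> h) \<le> e * t"
      using d(2)[of w] wb sub t N nw by (auto simp: w_def)
    obtain q where q: "\<And>v. v \<in> ball z r \<Longrightarrow> u v \<le> u w + q \<bullet> (v - w) + C / 2 * (norm (v - w))\<^sup>2"
      using sc[OF wb] by blast
    have yw: "y - w = (1 - t) *\<^sub>R h" by (simp add: w_def h_def algebra_simps)
    have xw: "x - w = - (t *\<^sub>R h)" by (simp add: w_def)
    have B1: "u y \<le> u w + (1 - t) * (q \<bullet> h) + C / 2 * ((1 - t)\<^sup>2 * N\<^sup>2)"
      using q[OF y] t unfolding yw by (simp add: N_def power_mult_distrib)
    have B2: "u x \<le> u w - t * (q \<bullet> h) + C / 2 * (t\<^sup>2 * N\<^sup>2)"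
      using q[OF x] t unfolding xw by (simp add: N_def power_mult_distrib)
    \<comment> \<open>Averaging the two bounds taken from \<open>w\<close> with weights
      \<open>t\<close> and \<open>1 - t\<close> cancels the unknown slope \<open>q\<close>. Every
      remaining error is proportional to \<open>t\<close>, which is divided out at the end.\<close>
    have "t * u y + (1 - t) * u x \<le> t * (u w + (1 - t) * (q \<bullet> h) + C / 2 * ((1 - t)\<^sup>2 * N\<^sup>2))
        + (1 - t) * (u w - t * (q \<bullet> h) + C / 2 * (t\<^sup>2 * N\<^sup>2))"
      using B1 B2 t by (intro add_mono mult_left_mono) auto
    also have "\<dots> = u w + C / 2 * (t * (1 - t) * N\<^sup>2)"
      by (simp add: field_simps power2_eq_square)
    also have "\<dots> \<le> u w + C / 2 * (t * N\<^sup>2)"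
      using \<open>C \<ge> 0\<close> t by (intro add_left_mono mult_left_mono mult_right_mono) auto
    finally have "t * (u y - u x) \<le> t * (p \<bullet> h + e + C / 2 * N\<^sup>2)"
      using A by (simp add: algebra_simps)
    then show "u y \<le> u x + p \<bullet> (y - x) + C / 2 * (norm (y - x))\<^sup>2 + e"
      using t by (simp add: h_def N_def)
  qed
qed auto

text \<open>Two linearly independent difference vectors have a nonzero 2 by 2 minor. Its indices
  name a coordinate plane onto which the triangle \<open>p0\<close>, \<open>p1\<close>,
  \<open>p2\<close> projects without degenerating.\<close>

lemma aff_dim_ge2_minor:
  fixes D :: "(real^'n) set"
  assumes "aff_dim D \<ge> 2"
  obtains p0 p1 p2 j k where "p0 \<in> D" "p1 \<in> D" "p2 \<in> D"
    "(p1 - p0) $ j * (p2 - p0) $ k - (p1 - p0) $ k * (p2 - p0) $ j \<noteq> 0"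
proof -
  obtain p0 where p0: "p0 \<in> D" using assms by fastforce
  have "\<not> D \<subseteq> {p0}" using assms aff_dim_subset[of D "{p0}"] by auto
  then obtain p1 where p1: "p1 \<in> D" "p1 \<noteq> p0" by auto
  then obtain j where j: "(p1 - p0) $ j \<noteq> 0" by (auto simp: vec_eq_iff)
  have "\<not> D \<subseteq> affine hull {p0, p1}"
    using assms aff_dim_subset[of D "affine hull {p0,p1}"] p1 by (auto simp: aff_dim_2)
  then obtain p2 where p2: "p2 \<in> D" "p2 \<notin> affine hull {p0, p1}" by auto
  have "\<exists>k. (p1 - p0) $ j * (p2 - p0) $ k \<noteq> (p1 - p0) $ k * (p2 - p0) $ j"
  proof (rule ccontr)
    assume "\<not> ?thesis"
    then have eq: "(p1 - p0) $ j * (p2 - p0) $ k = (p1 - p0) $ k * (p2 - p0) $ j" for k by blast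
    \<comment> \<open>If all minors through index \<open>j\<close> vanished, \<open>p2 - p0\<close>
      would be the multiple of \<open>p1 - p0\<close> with this factor, putting \<open>p2\<close> on
      the line through \<open>p0\<close> and \<open>p1\<close>.\<close>
    define c where "c = (p2 - p0) $ j / (p1 - p0) $ j"
    have "p2 = (1 - c) *\<^sub>R p0 + c *\<^sub>R p1"
    proof (unfold vec_eq_iff, intro allI)
      fix k
      have "(p2 - p0) $ k = c * (p1 - p0) $ k"
        using eq[of k] j unfolding c_def by (simp add: field_simps del: vector_minus_component)
      then show "p2 $ k = ((1 - c) *\<^sub>R p0 + c *\<^sub>R p1) $ k" by (simp add: algebra_simps)
    qed
    then have "p2 \<in> affine hull {p0, p1}"
      unfolding affine_hull_2 by (intro CollectI exI[of _ "1 - c"] exI[of _ c] conjI) auto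
    then show False using p2 by simp
  qed
  then show ?thesis using that p0 p1 p2 by (metis right_minus_eq)
qed

text \<open>A nondegenerate planar triangle has interior points, and rational points are dense. The
  point with both weights equal to 1/4 is moved to a nearby rational point, and Cramer's rule
  recovers the new weights.\<close>

lemma rational_point_in_triangle:
  fixes c1 c2 v1 v2 w1 w2 :: real
  assumes d: "v1 * w2 - v2 * w1 \<noteq> 0"
  obtains \<alpha> \<beta> where "0 \<le> \<alpha>" "0 \<le> \<beta>" "\<alpha> + \<beta> \<le> 1"
    "c1 + \<alpha> * v1 + \<beta> * w1 \<in> \<rat>" "c2 + \<alpha> * v2 + \<beta> * w2 \<in> \<rat>"
proof -
  define D where "D = v1 * w2 - v2 * w1"
  define M where "M = 1 + \<bar>v1\<bar> + \<bar>v2\<bar> + \<bar>w1\<bar> + \<bar>w2\<bar>"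
  \<comment> \<open>With this tolerance Cramer's rule changes each weight by at most 1/8, so both
    stay between 1/8 and 3/8.\<close>
  define \<epsilon> where "\<epsilon> = \<bar>D\<bar> / (8 * M)"
  have M: "M > 0" unfolding M_def by simp
  have D: "D \<noteq> 0" using d by (simp add: D_def)
  then have \<epsilon>: "\<epsilon> > 0" using M by (simp add: \<epsilon>_def)
  have *: "\<exists>\<delta>. \<bar>\<delta>\<bar> \<le> \<epsilon> \<and> c + \<delta> \<in> \<rat>" for c :: real
  proof -
    obtain q where "q \<in> \<rat>" "c < q" "q < c + \<epsilon>" using Rats_dense_in_real[of c "c + \<epsilon>"] \<epsilon> by auto
    then show ?thesis by (intro exI[of _ "q - c"]) auto
  qed
  obtain d1 where d1: "\<bar>d1\<bar> \<le> \<epsilon>" "c1 + v1 / 4 + w1 / 4 + d1 \<in> \<rat>" using *[of "c1 + v1/4 + w1/4"] by auto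
  obtain d2 where d2: "\<bar>d2\<bar> \<le> \<epsilon>" "c2 + v2 / 4 + w2 / 4 + d2 \<in> \<rat>" using *[of "c2 + v2/4 + w2/4"] by auto
  have bd: "\<bar>(s * d1 - t * d2) / D\<bar> \<le> 1 / 8" if "\<bar>s\<bar> + \<bar>t\<bar> \<le> M" for s t
  proof -
    have "\<bar>s * d1 - t * d2\<bar> \<le> \<bar>s\<bar> * \<bar>d1\<bar> + \<bar>t\<bar> * \<bar>d2\<bar>"
      by (metis abs_mult abs_triangle_ineq4)
    also have "\<dots> \<le> \<bar>s\<bar> * \<epsilon> + \<bar>t\<bar> * \<epsilon>" using d1 d2 by (intro add_mono mult_left_mono) auto
    also have "\<dots> = (\<bar>s\<bar> + \<bar>t\<bar>) * \<epsilon>" by (simp add: algebra_simps)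
    also have "\<dots> \<le> M * \<epsilon>" using that \<epsilon> by (intro mult_right_mono) auto
    also have "\<dots> = \<bar>D\<bar> / 8" using M by (simp add: \<epsilon>_def)
    finally show ?thesis using D by (simp add: abs_divide divide_simps)
  qed
  define \<alpha> where "\<alpha> = 1/4 + (w2 * d1 - w1 * d2) / D"
  define \<beta> where "\<beta> = 1/4 + ((- v2) * d1 - (- v1) * d2) / D"
  have "\<bar>(w2 * d1 - w1 * d2) / D\<bar> \<le> 1/8" "\<bar>((- v2) * d1 - (- v1) * d2) / D\<bar> \<le> 1/8"
    by (rule bd; simp add: M_def)+
  then have "0 \<le> \<alpha>" "0 \<le> \<beta>" "\<alpha> + \<beta> \<le> 1" unfolding \<alpha>_def \<beta>_def by linarith+
  moreover have "\<alpha> * v1 + \<beta> * w1 = v1 / 4 + w1 / 4 + d1"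
  proof -
    have "\<alpha> * v1 + \<beta> * w1 = v1 / 4 + w1 / 4 + (d1 * D) / D"
      unfolding \<alpha>_def \<beta>_def D_def by (simp add: algebra_simps add_divide_distrib diff_divide_distrib)
    then show ?thesis using D by simp
  qed
  moreover have "\<alpha> * v2 + \<beta> * w2 = v2 / 4 + w2 / 4 + d2"
  proof -
    have "\<alpha> * v2 + \<beta> * w2 = v2 / 4 + w2 / 4 + (d2 * D) / D"
      unfolding \<alpha>_def \<beta>_def D_def by (simp add: algebra_simps add_divide_distrib diff_divide_distrib)
    then show ?thesis using D by simp
  qed
  ultimately show ?thesis using that[of \<alpha> \<beta>] d1 d2 by (simp add: add.assoc)
qed

definition upd_coord :: "'n \<Rightarrow> real \<Rightarrow> real^'n \<Rightarrow> real^'n" where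
  "upd_coord j q y = (\<chi> i. if i = j then q else y $ i)"

lemma norm_upd_coord_diff_le: "norm (upd_coord j q y - upd_coord j q y') \<le> norm (y - y')"
  by (rule norm_le_componentwise_cart) (simp add: upd_coord_def)

text \<open>
  In the proof, the coordinate \<open>y $ j\<close>, which is pinned to \<open>q\<close> before applying the Lipschitz
  function \<open>J\<close>, is free to carry the scaling parameter \<open>s\<close> of the cone. The cone is thus
  parametrised by the hyperplane \<open>y $ k = r\<close>.
\<close>
lemma negligible_cone_high_dim_fibres:
  fixes Q :: "real^'n \<Rightarrow> (real^'n) set"
  assumes conv: "\<And>x. x \<in> B \<Longrightarrow> convex (Q x)"
    and mono: "\<And>x y p q. \<lbrakk>x \<in> B; y \<in> B; p \<in> Q x; q \<in> Q y\<rbrakk> \<Longrightarrow>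
                 (p - q) \<bullet> (x - y) \<le> C * (norm (x - y))\<^sup>2"
  shows "negligible {a + s *\<^sub>R (x - a) | s x. x \<in> B \<and> aff_dim (Q x) \<ge> 2}"
proof -
  \<comment> \<open>\<open>G x y\<close> says that \<open>y = (C + 1) x - p\<close> for some
    \<open>p\<close> in \<open>Q x\<close>. By \<open>mono\<close>, subtracting \<open>p\<close>
    from \<open>C x\<close> gives a monotone relation; the extra \<open>x\<close> makes it strongly
    monotone with constant 1, so its inverse is single-valued and 1-Lipschitz.\<close>
  define G where "G = (\<lambda>x y. x \<in> B \<and> (C + 1) *\<^sub>R x - y \<in> Q x)"
  have G_lip: "norm (x - x') \<le> norm (y - y')" if "G x y" "G x' y'" for x x' y y'
  proof -
    have "(((C + 1) *\<^sub>R x - y) - ((C + 1) *\<^sub>R x' - y')) \<bullet> (x - x') \<le> C * (norm (x - x'))\<^sup>2"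
      using that mono unfolding G_def by blast
    moreover have "((C + 1) *\<^sub>R x - y) - ((C + 1) *\<^sub>R x' - y') = (C + 1) *\<^sub>R (x - x') - (y - y')"
      by (simp add: algebra_simps)
    ultimately have "(norm (x - x'))\<^sup>2 \<le> (y - y') \<bullet> (x - x')"
      by (simp add: inner_diff_left power2_norm_eq_inner algebra_simps)
    also have "\<dots> \<le> norm (y - y') * norm (x - x')" by (rule norm_cauchy_schwarz)
    finally have "norm (x - x') * norm (x - x') \<le> norm (y - y') * norm (x - x')"
      by (simp add: power2_eq_square)
    then show ?thesis
      by (metis mult_right_le_imp_le norm_ge_zero order_le_less)
  qed
  \<comment> \<open>The value of \<open>J\<close> is arbitrary where no \<open>x\<close> satisfies
    \<open>G x y\<close>; the sets \<open>S i\<close> below admit only \<open>y\<close> whose pinned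
    version does have such an \<open>x\<close>.\<close>
  define J where "J = (\<lambda>y. SOME x. G x y)"
  have GJ: "G (J y) y" if "G x y" for x y unfolding J_def using that by (rule someI)
  have J_eq: "J y = x" if "G x y" for x y
    using G_lip[OF GJ[OF that] that] by simp
  define S where "S = (\<lambda>(j, k, q, r). {y. y $ k = r \<and> (\<exists>x. G x (upd_coord j q y))})"
  define F where "F = (\<lambda>(j::'n, k::'n, q, r::real) y. a + y $ j *\<^sub>R (J (upd_coord j q y) - a))"
  define I where "I = {(j::'n, k::'n, q, r). j \<noteq> k \<and> q \<in> (\<rat>::real set) \<and> r \<in> (\<rat>::real set)}"
  have "countable I"
  proof (rule countable_subset)
    show "I \<subseteq> UNIV \<times> UNIV \<times> \<rat> \<times> \<rat>" unfolding I_def by auto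
    show "countable ((UNIV :: 'n set) \<times> (UNIV :: 'n set) \<times> (\<rat>::real set) \<times> (\<rat>::real set))"
      by (intro countable_SIGMA countable_finite countable_rat) auto
  qed
  have neg: "negligible (F i ` S i)" for i
  proof -
    obtain j k q r where i: "i = (j, k, q, r)" by (cases i)
    show ?thesis
    proof (rule negligible_locally_Lipschitz_image)
      have "negligible {y :: real^'n. axis k 1 \<bullet> y = r}"
        by (rule negligible_hyperplane) (simp add: axis_eq_0_iff)
      then show "negligible (S i)"
        by (rule negligible_subset) (auto simp: S_def i inner_axis')
    next
      fix y0 assume y0: "y0 \<in> S i"
      \<comment> \<open>\<open>F i\<close> is a product of the coordinate \<open>y $ j\<close> and a
        1-Lipschitz factor, so it is Lipschitz only where \<open>y $ j\<close> is bounded. The unit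
        ball around \<open>y0\<close> provides the bound
        \<open>\<bar>y0 $ j\<bar> + 1\<close>.\<close>
      define K where "K = \<bar>y0 $ j\<bar> + 1 + norm (J (upd_coord j q y0) - a)"
      have "norm (F i y - F i y0) \<le> K * norm (y - y0)" if y: "y \<in> S i \<inter> ball y0 1" for y
      proof -
        define x where "x = J (upd_coord j q y)"
        define x0 where "x0 = J (upd_coord j q y0)"
        have "norm (x - x0) \<le> norm (upd_coord j q y - upd_coord j q y0)"
          using y y0 unfolding x_def x0_def S_def i by (auto intro!: G_lip GJ)
        then have xx: "norm (x - x0) \<le> norm (y - y0)" using norm_upd_coord_diff_le order_trans by blast
        have yj: "\<bar>y $ j - y0 $ j\<bar> \<le> norm (y - y0)"
          using component_le_norm_cart[of "y - y0" j] by simp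
        have "norm (y - y0) < 1" using y by (simp add: dist_norm norm_minus_commute)
        then have yj': "\<bar>y $ j\<bar> \<le> \<bar>y0 $ j\<bar> + 1" using yj by linarith
        have "F i y - F i y0 = y $ j *\<^sub>R (x - x0) + (y $ j - y0 $ j) *\<^sub>R (x0 - a)"
          unfolding F_def i x_def x0_def by (simp add: algebra_simps)
        then have "norm (F i y - F i y0) \<le> \<bar>y $ j\<bar> * norm (x - x0) + \<bar>y $ j - y0 $ j\<bar> * norm (x0 - a)"
          by (metis norm_triangle_ineq norm_scaleR)
        also have "\<dots> \<le> (\<bar>y0 $ j\<bar> + 1) * norm (y - y0) + norm (y - y0) * norm (x0 - a)"
          using xx yj yj' by (intro add_mono mult_mono) auto
        also have "\<dots> = K * norm (y - y0)" by (simp add: K_def x0_def algebra_simps)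
        finally show ?thesis .
      qed
      then show "\<exists>T K. open T \<and> y0 \<in> T \<and> (\<forall>y\<in>S i \<inter> T. norm (F i y - F i y0) \<le> K * norm (y - y0))"
        by (intro exI[of _ "ball y0 1"] exI[of _ K]) auto
    qed simp
  qed
  have "{a + s *\<^sub>R (x - a) | s x. x \<in> B \<and> aff_dim (Q x) \<ge> 2} \<subseteq> (\<Union>i\<in>I. F i ` S i)"
  proof clarify
    fix s x assume x: "x \<in> B" "aff_dim (Q x) \<ge> 2"
    obtain p0 p1 p2 j k where p: "p0 \<in> Q x" "p1 \<in> Q x" "p2 \<in> Q x"
      and det: "(p1 - p0) $ j * (p2 - p0) $ k - (p1 - p0) $ k * (p2 - p0) $ j \<noteq> 0"
      using aff_dim_ge2_minor[OF x(2)] by metis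
    then have jk: "j \<noteq> k" by auto
    \<comment> \<open>The offset is chosen so that
      \<open>c + \<alpha> (p1 - p0) + \<beta> (p2 - p0)\<close> is \<open>- y\<close> for the point
      \<open>y\<close> defined below; rational entries \<open>j\<close> and \<open>k\<close> of this
      sum are thus rational entries of \<open>y\<close>.\<close>
    define c where "c = p0 - (C + 1) *\<^sub>R x"
    obtain \<alpha> \<beta> where ab: "0 \<le> \<alpha>" "0 \<le> \<beta>" "\<alpha> + \<beta> \<le> 1"
      "c $ j + \<alpha> * (p1 - p0) $ j + \<beta> * (p2 - p0) $ j \<in> \<rat>"
      "c $ k + \<alpha> * (p1 - p0) $ k + \<beta> * (p2 - p0) $ k \<in> \<rat>"
      using rational_point_in_triangle[OF det] by metis
    define P where "P = (1 - \<alpha> - \<beta>) *\<^sub>R p0 + \<alpha> *\<^sub>R p1 + \<beta> *\<^sub>R p2"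
    have P: "P \<in> Q x"
    proof -
      have "P \<in> convex hull {p0, p1, p2}"
        unfolding P_def convex_hull_3 using ab
        by (intro CollectI exI[of _ "1 - \<alpha> - \<beta>"] exI[of _ \<alpha>] exI[of _ \<beta>] conjI) auto
      also have "\<dots> \<subseteq> Q x" using p conv[OF x(1)] by (intro hull_minimal) auto
      finally show ?thesis .
    qed
    define y where "y = (C + 1) *\<^sub>R x - P"
    have "- (y $ l) = c $ l + \<alpha> * (p1 - p0) $ l + \<beta> * (p2 - p0) $ l" for l
      by (simp add: y_def P_def c_def algebra_simps)
    then have "- (y $ j) \<in> \<rat>" "- (y $ k) \<in> \<rat>" using ab by simp_all
    then have rat: "y $ j \<in> \<rat>" "y $ k \<in> \<rat>" by (auto simp: Rats_minus_iff)
    have "G x y" using x P by (simp add: G_def y_def)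
    \<comment> \<open>Slot \<open>j\<close> now stores the scale \<open>s\<close>. Pinning it back
      to the rational value \<open>y $ j\<close> recovers \<open>y\<close>, and \<open>J\<close>
      then returns \<open>x\<close>.\<close>
    define y' where "y' = upd_coord j s y"
    have y': "upd_coord j (y $ j) y' = y" "y' $ j = s" "y' $ k = y $ k"
      using jk by (auto simp: y'_def upd_coord_def vec_eq_iff)
    have "(j, k, y $ j, y $ k) \<in> I" using jk rat by (simp add: I_def)
    moreover have "a + s *\<^sub>R (x - a) = F (j, k, y $ j, y $ k) y'"
      using y' J_eq[OF \<open>G x y\<close>] by (simp add: F_def)
    moreover have "y' \<in> S (j, k, y $ j, y $ k)"
      using y' \<open>G x y\<close> by (auto simp: S_def)
    ultimately show "a + s *\<^sub>R (x - a) \<in> (\<Union>i\<in>I. F i ` S i)" by blast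
  qed
  moreover have "negligible (\<Union>i\<in>I. F i ` S i)"
    using \<open>countable I\<close> neg by (intro negligible_countable_Union) auto
  ultimately show ?thesis by (rule negligible_subset[rotated])
qed

text \<open>The superdifferential at \<open>x\<close> is enclosed in the set \<open>Q x\<close> of
  slopes satisfying the quadratic bound on the whole ball. \<open>Q x\<close> is convex as an
  intersection of half-spaces, and adding the bounds at two points gives the monotonicity required
  of the fibres.\<close>

lemma negligible_cone_singular:
  fixes u :: "real^'n \<Rightarrow> real"
  assumes sub: "ball z r \<subseteq> S" and "C \<ge> 0"
    and sc: "\<And>x. x \<in> ball z r \<Longrightarrow> \<exists>p. \<forall>y\<in>ball z r.
            u y \<le> u x + p \<bullet> (y - x) + C / 2 * (norm (y - x))\<^sup>2"
  shows "negligible {a + s *\<^sub>R (x - a) | s x. x \<in> ball z r \<and> aff_dim (superdiff S u x) \<ge> 2}"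
proof -
  define Q where "Q = (\<lambda>x. {p. \<forall>y\<in>ball z r. u y \<le> u x + p \<bullet> (y - x) + C / 2 * (norm (y - x))\<^sup>2})"
  have "negligible {a + s *\<^sub>R (x - a) | s x. x \<in> ball z r \<and> aff_dim (Q x) \<ge> 2}"
  proof (rule negligible_cone_high_dim_fibres)
    fix x
    have "Q x = (\<Inter>y\<in>ball z r. {p. (y - x) \<bullet> p \<ge> u y - u x - C / 2 * (norm (y - x))\<^sup>2})"
      unfolding Q_def by (auto simp: inner_commute algebra_simps)
    then show "convex (Q x)" by (simp add: convex_INT convex_halfspace_ge)
  next
    fix x y p q assume "x \<in> ball z r" "y \<in> ball z r" "p \<in> Q x" "q \<in> Q y"
    then have "u y \<le> u x + p \<bullet> (y - x) + C / 2 * (norm (y - x))\<^sup>2"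
      "u x \<le> u y + q \<bullet> (x - y) + C / 2 * (norm (x - y))\<^sup>2" unfolding Q_def by blast+
    then show "(p - q) \<bullet> (x - y) \<le> C * (norm (x - y))\<^sup>2"
      by (simp add: norm_minus_commute[of y x] inner_diff_left inner_diff_right)
  qed
  moreover have "superdiff S u x \<subseteq> Q x" if "x \<in> ball z r" for x
    using superdiff_quadratic_bound[OF sub \<open>C \<ge> 0\<close> sc that] unfolding Q_def by blast
  then have "aff_dim (superdiff S u x) \<le> aff_dim (Q x)" if "x \<in> ball z r" for x
    using that by (intro aff_dim_subset)
  then have "{a + s *\<^sub>R (x - a) | s x. x \<in> ball z r \<and> aff_dim (superdiff S u x) \<ge> 2}
      \<subseteq> {a + s *\<^sub>R (x - a) | s x. x \<in> ball z r \<and> aff_dim (Q x) \<ge> 2}"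
    by (fastforce intro: order_trans)
  ultimately show ?thesis by (rule negligible_subset)
qed

section \<open>Chart independence of the singular set\<close>

text \<open>\<open>smooth_on\<close> speaks only of partial derivatives, while the chain rule needs
  a Frechet derivative. The passage from \<open>x\<close> to \<open>y\<close> is made one coordinate
  at a time, with the mean value inequality on each step.\<close>

lemma has_derivative_continuous_partials:
  fixes f :: "'a::euclidean_space \<Rightarrow> 'b::real_normed_vector"
  assumes "open S" "x \<in> S"
    and partial: "\<And>i y. i \<in> Basis \<Longrightarrow> y \<in> S \<Longrightarrow>
       ((\<lambda>t. f (y + t *\<^sub>R i)) has_vector_derivative D i y) (at 0)"
    and cont: "\<And>i. i \<in> Basis \<Longrightarrow> continuous_on S (D i)"
  shows "(f has_derivative (\<lambda>h. \<Sum>i\<in>Basis. (h \<bullet> i) *\<^sub>R D i x)) (at x)"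
proof -
  have lin: "bounded_linear (\<lambda>h. \<Sum>i\<in>Basis. (h \<bullet> i) *\<^sub>R D i x)"
    by (intro bounded_linear_sum bounded_linear_scaleR_const bounded_linear_inner_left)
  have "\<exists>d>0. \<forall>y. norm (y - x) < d \<longrightarrow>
      norm (f y - f x - (\<Sum>i\<in>Basis. ((y - x) \<bullet> i) *\<^sub>R D i x)) \<le> e * norm (y - x)"
    if "e > 0" for e
  proof -
    define m where "m = real DIM('a)"
    have m: "m > 0" by (simp add: m_def)
    have "\<forall>i\<in>Basis. \<exists>d>0. \<forall>y\<in>ball x d. y \<in> S \<and> norm (D i y - D i x) \<le> e / m"
    proof
      fix i :: 'a assume i: "i \<in> Basis"
      have "isCont (D i) x"
        using cont[OF i] \<open>open S\<close> \<open>x \<in> S\<close> by (simp add: continuous_on_eq_continuous_at)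
      moreover have "e / m > 0" using \<open>e > 0\<close> m by simp
      ultimately obtain d1 where d1: "d1 > 0" "\<And>y. dist y x < d1 \<Longrightarrow> dist (D i y) (D i x) < e / m"
        unfolding continuous_at_eps_delta by metis
      obtain d2 where d2: "d2 > 0" "ball x d2 \<subseteq> S" using \<open>open S\<close> \<open>x \<in> S\<close> open_contains_ball by blast
      show "\<exists>d>0. \<forall>y\<in>ball x d. y \<in> S \<and> norm (D i y - D i x) \<le> e / m"
        using d1 d2 by (intro exI[of _ "min d1 d2"]) (force simp: dist_norm norm_minus_commute)
    qed
    then obtain \<delta> where \<delta>: "\<And>i. i \<in> Basis \<Longrightarrow> \<delta> i > 0"
      "\<And>i y. i \<in> Basis \<Longrightarrow> y \<in> ball x (\<delta> i) \<Longrightarrow> y \<in> S \<and> norm (D i y - D i x) \<le> e / m"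
      unfolding bchoice_iff by metis
    \<comment> \<open>The division by \<open>m\<close> leaves room for the crude estimate that every
      intermediate point is within \<open>m * norm h\<close> of \<open>x\<close>.\<close>
    define d where "d = Min (\<delta> ` (Basis :: 'a set)) / m"
    have "Min (\<delta> ` (Basis :: 'a set)) > 0" using \<delta>(1) by (subst Min_gr_iff) auto
    then have "d > 0" using m by (simp add: d_def)
    have dm: "y \<in> S \<and> norm (D i y - D i x) \<le> e / m" if "i \<in> Basis" "norm (y - x) < m * d" for i y
    proof -
      have "m * d \<le> \<delta> i" using that(1) m by (simp add: d_def)
      then show ?thesis using that \<delta>(2)[of i y] by (simp add: dist_norm norm_minus_commute)
    qed
    have "norm (f y - f x - (\<Sum>i\<in>Basis. ((y - x) \<bullet> i) *\<^sub>R D i x)) \<le> e * norm (y - x)"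
      if y: "norm (y - x) < d" for y
    proof -
      define h where "h = y - x"
      \<comment> \<open>Induction on the set \<open>I\<close> of coordinates already moved; each new
        coordinate costs at most \<open>e / m * norm h\<close>, so all of them together cost
        \<open>e * norm h\<close>.\<close>
      have *: "norm (f (x + (\<Sum>i\<in>I. (h \<bullet> i) *\<^sub>R i)) - f x - (\<Sum>i\<in>I. (h \<bullet> i) *\<^sub>R D i x))
                \<le> real (card I) * (e / m * norm h)" if "I \<subseteq> Basis" for I
      proof -
        have "finite I" using that finite_Basis by (rule finite_subset)
        then show ?thesis using that
        proof (induction I rule: finite_induct)
          case (insert j I)
          define w where "w = x + (\<Sum>i\<in>I. (h \<bullet> i) *\<^sub>R i)"
          define g where "g = (\<lambda>t. f (w + t *\<^sub>R j))"
          have j: "j \<in> Basis" using insert by auto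
          have near: "norm (w + t *\<^sub>R j - x) < m * d" if "\<bar>t\<bar> \<le> \<bar>h \<bullet> j\<bar>" for t
          proof -
            have "norm (w + t *\<^sub>R j - x) \<le> norm (\<Sum>i\<in>I. (h \<bullet> i) *\<^sub>R i) + norm (t *\<^sub>R j)"
              unfolding w_def by (metis (no_types, lifting) add.assoc add_diff_cancel_left' norm_triangle_ineq)
            also have "\<dots> \<le> (\<Sum>i\<in>I. norm h) + norm h"
            proof (rule add_mono)
              show "norm (\<Sum>i\<in>I. (h \<bullet> i) *\<^sub>R i) \<le> (\<Sum>i\<in>I. norm h)"
              proof (rule sum_norm_le)
                fix i assume "i \<in> I"
                then have "i \<in> Basis" using insert.prems by auto
                then show "norm ((h \<bullet> i) *\<^sub>R i) \<le> norm h" by (simp add: Basis_le_norm)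
              qed
              show "norm (t *\<^sub>R j) \<le> norm h" using that j Basis_le_norm[OF j, of h] by simp
            qed
            also have "\<dots> = real (card (insert j I)) * norm h"
              using insert by (simp add: algebra_simps)
            also have "\<dots> \<le> m * norm h"
              unfolding m_def using insert.prems by (intro mult_right_mono) (auto intro!: card_mono)
            also have "\<dots> < m * d" using y m by (simp add: h_def)
            finally show ?thesis .
          qed
          have der: "(g has_vector_derivative D j (w + t *\<^sub>R j)) (at t within T)"
            if "\<bar>t\<bar> \<le> \<bar>h \<bullet> j\<bar>" for t T
          proof -
            have "((\<lambda>s. f ((w + t *\<^sub>R j) + s *\<^sub>R j)) has_vector_derivative D j (w + t *\<^sub>R j)) (at 0)"
              using partial[OF j] dm[OF j near[OF that]] by blast
            then have "((\<lambda>s. g (t + s)) has_vector_derivative D j (w + t *\<^sub>R j)) (at 0)"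
              by (simp add: g_def algebra_simps)
            then have "(g has_vector_derivative D j (w + t *\<^sub>R j)) (at t)"
              unfolding has_vector_derivative_def has_derivative_at by simp
            then show ?thesis by (rule has_vector_derivative_at_within)
          qed
          define T where "T = closed_segment 0 (h \<bullet> j)"
          have T: "\<bar>t\<bar> \<le> \<bar>h \<bullet> j\<bar>" if "t \<in> T" for t
            using that by (auto simp: T_def closed_segment_eq_real_ivl split: if_splits)
          \<comment> \<open>Subtracting the linear function with slope \<open>D j x\<close> leaves
            the derivative \<open>D j (w + t *\<^sub>R j) - D j x\<close>, which continuity makes at
            most \<open>e / m\<close> in norm.\<close>
          have "norm ((g (h \<bullet> j) - (h \<bullet> j) *\<^sub>R D j x) - (g 0 - 0 *\<^sub>R D j x))
                 \<le> e / m * norm (h \<bullet> j - 0)"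
          proof (rule differentiable_bound[of T])
            show "convex T" "h \<bullet> j \<in> T" "0 \<in> T" by (auto simp: T_def)
            fix t assume t: "t \<in> T"
            show "((\<lambda>t. g t - t *\<^sub>R D j x) has_derivative (\<lambda>s. s *\<^sub>R (D j (w + t *\<^sub>R j) - D j x))) (at t within T)"
              using der[OF T[OF t], of T] unfolding has_vector_derivative_def
              by (auto intro!: derivative_eq_intros simp: algebra_simps)
            show "onorm (\<lambda>s. s *\<^sub>R (D j (w + t *\<^sub>R j) - D j x)) \<le> e / m"
              using dm[OF j near[OF T[OF t]]]
                mult_right_mono[of "norm (D j (w + t *\<^sub>R j) - D j x)" "e / m" "\<bar>s\<bar>" for s]
              by (intro onorm_le) (simp add: mult.commute)
          qed
          also have "\<dots> \<le> e / m * norm h"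
            using \<open>e > 0\<close> m Basis_le_norm[OF j, of h] by (intro mult_left_mono) auto
          finally have step: "norm (g (h \<bullet> j) - g 0 - (h \<bullet> j) *\<^sub>R D j x) \<le> e / m * norm h"
            by (simp add: algebra_simps)
          have IH: "norm (f w - f x - (\<Sum>i\<in>I. (h \<bullet> i) *\<^sub>R D i x)) \<le> real (card I) * (e / m * norm h)"
            using insert unfolding w_def by auto
          have "f (x + (\<Sum>i\<in>insert j I. (h \<bullet> i) *\<^sub>R i)) - f x - (\<Sum>i\<in>insert j I. (h \<bullet> i) *\<^sub>R D i x)
              = (f w - f x - (\<Sum>i\<in>I. (h \<bullet> i) *\<^sub>R D i x)) + (g (h \<bullet> j) - g 0 - (h \<bullet> j) *\<^sub>R D j x)"
            using insert(1,2) by (simp add: g_def w_def algebra_simps)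
          also have "norm \<dots> \<le> real (card I) * (e / m * norm h) + e / m * norm h"
            using IH step by (rule norm_triangle_mono)
          also have "\<dots> = real (card (insert j I)) * (e / m * norm h)"
            using insert(1,2) by (simp add: add_divide_distrib algebra_simps)
          finally show ?case .
        qed simp
      qed
      show ?thesis
        using *[of Basis] m by (simp add: euclidean_representation h_def m_def)
    qed
    then show ?thesis using \<open>d > 0\<close> by blast
  qed
  then show ?thesis using lin unfolding has_derivative_at_alt by simp
qed

lemma smooth_on_imp_has_derivative:
  assumes "smooth_on S f" "open S" "x \<in> S"
  obtains f' where "(f has_derivative f') (at x)"
proof -
  obtain F where F: "f \<in> F" "\<And>g. g \<in> F \<Longrightarrow> continuous_on S g"
    "\<And>g i. g \<in> F \<Longrightarrow> i \<in> Basis \<Longrightarrow> \<exists>g'\<in>F. \<forall>x\<in>S. ((\<lambda>t. g (x + t *\<^sub>R i)) has_vector_derivative g' x) (at 0)"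
    using assms(1) unfolding smooth_on_def by blast
  have "\<forall>i\<in>Basis. \<exists>g'. g' \<in> F \<and> (\<forall>x\<in>S. ((\<lambda>t. f (x + t *\<^sub>R i)) has_vector_derivative g' x) (at 0))"
    using F(3)[OF F(1)] by blast
  then obtain D where D: "\<And>i. i \<in> Basis \<Longrightarrow> D i \<in> F"
    "\<And>i x. i \<in> Basis \<Longrightarrow> x \<in> S \<Longrightarrow> ((\<lambda>t. f (x + t *\<^sub>R i)) has_vector_derivative D i x) (at 0)"
    unfolding bchoice_iff by metis
  then show thesis
    using that has_derivative_continuous_partials[OF assms(2,3), of f D] F(2) by metis
qed

text \<open>Supergradients pull back by the adjoint of the derivative: with \<open>R\<close> the
  remainder of \<open>T\<close> at \<open>x\<close>, \<open>p \<bullet> (T y - T x)\<close> is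
  \<open>adjoint T' p \<bullet> (y - x)\<close> plus \<open>p \<bullet> R\<close>, and
  \<open>p \<bullet> R\<close> is of smaller order than \<open>y - x\<close>.\<close>

lemma superdiff_chain:
  fixes u v :: "real^'n \<Rightarrow> real" and T :: "real^'n \<Rightarrow> real^'n"
  assumes der: "(T has_derivative T') (at x)"
    and W: "open W" "x \<in> W" "\<And>y. y \<in> W \<Longrightarrow> T y \<in> S'" "\<And>y. y \<in> W \<Longrightarrow> u y = v (T y)"
    and p: "p \<in> superdiff S' v (T x)"
  shows "adjoint T' p \<in> superdiff S u x"
  unfolding superdiff_def
proof (intro CollectI allI impI)
  fix e :: real assume "e > 0"
  have lin: "linear T'" using der has_derivative_linear by blast
  obtain K where K: "K > 0" "\<And>h. norm (T' h) \<le> norm h * K"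
    using der bounded_linear.pos_bounded has_derivative_bounded_linear by blast
  \<comment> \<open>The error \<open>e\<close> is halved. \<open>e1\<close> absorbs the factor
    \<open>K + 1\<close> by which \<open>T\<close> can stretch near \<open>x\<close>, and
    \<open>e2\<close> absorbs \<open>norm p\<close> in the remainder term; \<open>e2 \<le> 1\<close>
    is what yields the stretching bound \<open>K + 1\<close>.\<close>
  define e1 where "e1 = e / (2 * (K + 1))"
  have e1: "e1 > 0" using \<open>e > 0\<close> K by (simp add: e1_def)
  define e2 where "e2 = min 1 (e / (2 * (norm p + 1)))"
  have np: "norm p + 1 > 0" by (smt (verit) norm_ge_zero)
  have e2: "e2 > 0" "e2 \<le> 1" "norm p * e2 \<le> e / 2"
  proof -
    show "e2 > 0" "e2 \<le> 1" using \<open>e > 0\<close> np by (auto simp: e2_def)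
    have "norm p * e2 \<le> (norm p + 1) * e2" using \<open>e2 > 0\<close> by simp
    also have "\<dots> \<le> (norm p + 1) * (e / (2 * (norm p + 1)))"
      using np by (intro mult_left_mono) (auto simp: e2_def)
    also have "\<dots> = e / 2" using np by (simp add: divide_simps)
    finally show "norm p * e2 \<le> e / 2" .
  qed
  obtain d1 where d1: "d1 > 0" "\<And>w. w \<in> S' \<Longrightarrow> norm (w - T x) < d1 \<Longrightarrow>
      v w - v (T x) - p \<bullet> (w - T x) \<le> e1 * norm (w - T x)"
    using p e1 unfolding superdiff_def by blast
  obtain d2 where d2: "d2 > 0" "\<And>y. norm (y - x) < d2 \<Longrightarrow> norm (T y - T x - T' (y - x)) \<le> e2 * norm (y - x)"
    using der e2(1) unfolding has_derivative_at_alt by blast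
  obtain d3 where d3: "d3 > 0" "ball x d3 \<subseteq> W" using W open_contains_ball by blast
  define d where "d = min (d1 / (K + 1)) (min d2 d3)"
  have "d > 0" using d1 d2 d3 K by (simp add: d_def)
  moreover have "u y - u x - adjoint T' p \<bullet> (y - x) \<le> e * norm (y - x)" if y: "norm (y - x) < d" for y
  proof -
    define R where "R = T y - T x - T' (y - x)"
    have R: "norm R \<le> e2 * norm (y - x)" using d2 y unfolding R_def d_def by auto
    have yW: "y \<in> W" using d3 y unfolding d_def by (auto simp: dist_norm norm_minus_commute)
    have "T y - T x = T' (y - x) + R" by (simp add: R_def)
    then have "norm (T y - T x) \<le> norm (T' (y - x)) + norm R" by (metis norm_triangle_ineq)
    also have "\<dots> \<le> norm (y - x) * K + 1 * norm (y - x)"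
      using K(2) order_trans[OF R mult_right_mono[OF e2(2)]] by (intro add_mono) auto
    finally have nT: "norm (T y - T x) \<le> (K + 1) * norm (y - x)" by (simp add: algebra_simps)
    also have "\<dots> < (K + 1) * d" using y K by simp
    also have "\<dots> \<le> (K + 1) * (d1 / (K + 1))" using K by (intro mult_left_mono) (auto simp: d_def)
    finally have "norm (T y - T x) < d1" using K by simp
    then have "v (T y) - v (T x) - p \<bullet> (T y - T x) \<le> e1 * norm (T y - T x)"
      using d1 W yW by blast
    also have "\<dots> \<le> e1 * ((K + 1) * norm (y - x))" using nT e1 by (intro mult_left_mono) auto
    also have "\<dots> = e / 2 * norm (y - x)" using K by (simp add: e1_def field_simps)
    finally have A: "v (T y) - v (T x) - p \<bullet> (T y - T x) \<le> e / 2 * norm (y - x)" .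
    have "p \<bullet> R \<le> norm p * norm R" by (rule norm_cauchy_schwarz)
    also have "\<dots> \<le> norm p * (e2 * norm (y - x))" using R by (intro mult_left_mono) auto
    also have "\<dots> \<le> e / 2 * norm (y - x)"
      using e2(3) by (metis (no_types) mult.assoc mult_right_mono norm_ge_zero)
    finally have B: "p \<bullet> R \<le> e / 2 * norm (y - x)" .
    have "adjoint T' p \<bullet> (y - x) = p \<bullet> (T y - T x) - p \<bullet> R"
      using adjoint_clauses(2)[OF lin] by (simp add: R_def inner_diff_right linear_diff[OF lin])
    then show ?thesis using A B W yW by (simp add: field_simps)
  qed
  ultimately show "\<exists>d>0. \<forall>y\<in>S. norm (y - x) < d \<longrightarrow> u y - u x - adjoint T' p \<bullet> (y - x) \<le> e * norm (y - x)"
    by blast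
qed

section \<open>Charts and transition maps of a smooth atlas\<close>

lemma chart_facts:
  assumes "smooth_atlas A" "(U, \<psi>) \<in> A"
  shows "open U" "open (\<psi> ` U)" "continuous_on U \<psi>" "inj_on \<psi> U"
    "continuous_on (\<psi> ` U) (inv_into U \<psi>)"
proof -
  obtain g where g: "homeomorphism U (\<psi> ` U) \<psi> g" and "open U" "open (\<psi> ` U)"
    using assms unfolding smooth_atlas_def by blast
  then show "open U" "open (\<psi> ` U)" by blast+
  show "continuous_on U \<psi>" using g by (simp add: homeomorphism_def)
  show inj: "inj_on \<psi> U" using g by (metis homeomorphism_def inj_on_inverseI)
  have "inv_into U \<psi> y = g y" if "y \<in> \<psi> ` U" for y
    using that g inj by (auto simp: homeomorphism_def)
  then show "continuous_on (\<psi> ` U) (inv_into U \<psi>)"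
    using g by (metis (no_types, lifting) continuous_on_cong homeomorphism_def)
qed

lemma chart_open_image:
  assumes "smooth_atlas A" "(U, \<psi>) \<in> A" "open N" "N \<subseteq> U"
  shows "open (\<psi> ` N)"
proof -
  note ch = chart_facts[OF assms(1,2)]
  have "\<psi> ` N = \<psi> ` U \<inter> inv_into U \<psi> -` N"
  proof
    show "\<psi> ` N \<subseteq> \<psi> ` U \<inter> inv_into U \<psi> -` N" using assms(4) ch(4) by (auto simp: subset_iff)
    show "\<psi> ` U \<inter> inv_into U \<psi> -` N \<subseteq> \<psi> ` N" using ch(4) by auto
  qed
  then show ?thesis using continuous_open_preimage[OF ch(5) ch(2) assms(3)] by simp
qed

lemma transition_has_derivative:
  assumes "smooth_atlas A" "(U, \<psi>) \<in> A" "(V, \<theta>) \<in> A" "x \<in> U" "x \<in> V"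
  obtains T' where "((\<theta> \<circ> inv_into U \<psi>) has_derivative T') (at (\<psi> x))"
proof (rule smooth_on_imp_has_derivative)
  show "smooth_on (\<psi> ` (U \<inter> V)) (\<theta> \<circ> inv_into U \<psi>)"
    using assms(1-3) unfolding smooth_atlas_def by blast
  show "open (\<psi> ` (U \<inter> V))"
    using chart_open_image[OF assms(1,2), of "U \<inter> V"] chart_facts(1)[OF assms(1,2)] chart_facts(1)[OF assms(1,3)]
    by auto
  show "\<psi> x \<in> \<psi> ` (U \<inter> V)" using assms by auto
qed

text \<open>The transition maps are mutually inverse, so the derivative \<open>T'\<close> is onto
  and its adjoint is injective. The adjoint therefore embeds one superdifferential into the other
  without lowering its affine dimension.\<close>

lemma aff_dim_superdiff_chart_le:
  fixes A :: "('a::topological_space set \<times> ('a \<Rightarrow> real^'n)) set"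
  assumes A: "smooth_atlas A" "(U, \<psi>) \<in> A" "(V, \<theta>) \<in> A" and x: "x \<in> U" "x \<in> V"
  shows "aff_dim (superdiff (\<theta> ` V) (\<phi> \<circ> inv_into V \<theta>) (\<theta> x))
     \<le> aff_dim (superdiff (\<psi> ` U) (\<phi> \<circ> inv_into U \<psi>) (\<psi> x))"
proof -
  note cU = chart_facts[OF A(1,2)] and cV = chart_facts[OF A(1,3)]
  obtain T' where T': "((\<theta> \<circ> inv_into U \<psi>) has_derivative T') (at (\<psi> x))"
    using transition_has_derivative[OF A x] .
  obtain R' where R': "((\<psi> \<circ> inv_into V \<theta>) has_derivative R') (at (\<theta> x))"
    using transition_has_derivative[OF A(1,3,2) x(2,1)] .
  have invx: "inv_into U \<psi> (\<psi> x) = x" "inv_into V \<theta> (\<theta> x) = x" using x cU(4) cV(4) by auto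
  define W where "W = \<theta> ` (U \<inter> V)"
  have W: "open W" "\<theta> x \<in> W"
    unfolding W_def using chart_open_image[OF A(1,3), of "U \<inter> V"] cU(1) cV(1) x by auto
  have "((\<theta> \<circ> inv_into U \<psi>) \<circ> (\<psi> \<circ> inv_into V \<theta>) has_derivative T' \<circ> R') (at (\<theta> x))"
    using diff_chain_at[OF R', of "\<theta> \<circ> inv_into U \<psi>" T'] T' invx by simp
  moreover have "((\<theta> \<circ> inv_into U \<psi>) \<circ> (\<psi> \<circ> inv_into V \<theta>) has_derivative id) (at (\<theta> x))"
  proof (rule has_derivative_transform_within_open[OF _ W])
    show "(id has_derivative id) (at (\<theta> x))" by (simp add: id_def)
  qed (use cU(4) cV(4) in \<open>auto simp: W_def\<close>)
  ultimately have "T' \<circ> R' = id" by (rule has_derivative_unique)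
  then have surj: "surj T'" by (metis comp_apply id_apply surjI)
  have lin: "linear T'" using T' has_derivative_linear by blast
  have "adjoint T' ` superdiff (\<theta> ` V) (\<phi> \<circ> inv_into V \<theta>) (\<theta> x)
      \<subseteq> superdiff (\<psi> ` U) (\<phi> \<circ> inv_into U \<psi>) (\<psi> x)"
  proof clarify
    fix p assume p: "p \<in> superdiff (\<theta> ` V) (\<phi> \<circ> inv_into V \<theta>) (\<theta> x)"
    show "adjoint T' p \<in> superdiff (\<psi> ` U) (\<phi> \<circ> inv_into U \<psi>) (\<psi> x)"
    proof (rule superdiff_chain[OF T'])
      show "open (\<psi> ` (U \<inter> V))" using chart_open_image[OF A(1,2), of "U \<inter> V"] cU(1) cV(1) by auto
      show "\<psi> x \<in> \<psi> ` (U \<inter> V)" using x by auto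
      show "p \<in> superdiff (\<theta> ` V) (\<phi> \<circ> inv_into V \<theta>) ((\<theta> \<circ> inv_into U \<psi>) (\<psi> x))"
        using p invx by simp
    qed (use cU(4) cV(4) in auto)
  qed
  then have "aff_dim (adjoint T' ` superdiff (\<theta> ` V) (\<phi> \<circ> inv_into V \<theta>) (\<theta> x))
      \<le> aff_dim (superdiff (\<psi> ` U) (\<phi> \<circ> inv_into U \<psi>) (\<psi> x))" by (rule aff_dim_subset)
  then show ?thesis using lin surj by (simp add: adjoint_linear)
qed

text \<open>\<open>Sigma_ge2\<close> asks for one suitable chart; the comparison of charts transfers
  the dimension bound to whichever chart around \<open>x\<close> is at hand.\<close>

lemma Sigma_ge2_chart:
  assumes "smooth_atlas A" "(U, \<psi>) \<in> A" "x \<in> U" "x \<in> Sigma_ge2 A \<phi>"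
  shows "aff_dim (superdiff (\<psi> ` U) (\<phi> \<circ> inv_into U \<psi>) (\<psi> x)) \<ge> 2"
  using assms(4) aff_dim_superdiff_chart_le[OF assms(1,2) _ assms(3)] order_trans
  unfolding Sigma_ge2_def by blast

section \<open>Broken lines\<close>

text \<open>Isolates the condition that \<open>broken_line\<close> imposes on one subinterval, so
  that curves can be reparametrised piece by piece.\<close>

definition linear_piece ::
  "('a::topological_space set \<times> ('a \<Rightarrow> real^'n)) set \<Rightarrow> (real \<Rightarrow> 'a) \<Rightarrow> real \<Rightarrow> real \<Rightarrow> bool" where
  "linear_piece A \<gamma> l r \<longleftrightarrow> (\<exists>(U,\<psi>)\<in>A. \<gamma> ` {l..r} \<subseteq> U \<and>
      (\<forall>s\<in>{l..r}. \<psi> (\<gamma> s) = \<psi> (\<gamma> l) + ((s - l) / (r - l)) *\<^sub>R (\<psi> (\<gamma> r) - \<psi> (\<gamma> l))))"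

lemma broken_line_iff:
  "broken_line A \<gamma> \<longleftrightarrow> continuous_on {0..1} \<gamma> \<and>
     (\<exists>k::nat. \<exists>t::nat \<Rightarrow> real. k \<ge> 1 \<and> t 0 = 0 \<and> t k = 1 \<and> (\<forall>i<k. t i < t (Suc i)) \<and>
        (\<forall>i<k. linear_piece A \<gamma> (t i) (t (Suc i))))"
  unfolding broken_line_def linear_piece_def ..

text \<open>Affine changes of time preserve the ratio \<open>(s - l) / (r - l)\<close>. The cases
  \<open>c = 0\<close> and \<open>c = 1\<close> are the first and second half of a joined
  path.\<close>

lemma linear_piece_reparam:
  assumes "linear_piece A \<gamma> l r" "l < r"
    and eq: "\<And>s. l \<le> 2 * s - c \<Longrightarrow> 2 * s - c \<le> r \<Longrightarrow> \<delta> s = \<gamma> (2 * s - c)"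
  shows "linear_piece A \<delta> ((l + c) / 2) ((r + c) / 2)"
proof -
  obtain U \<psi> where U: "(U, \<psi>) \<in> A" "\<gamma> ` {l..r} \<subseteq> U"
    "\<And>s. s \<in> {l..r} \<Longrightarrow> \<psi> (\<gamma> s) = \<psi> (\<gamma> l) + ((s - l) / (r - l)) *\<^sub>R (\<psi> (\<gamma> r) - \<psi> (\<gamma> l))"
    using assms(1) unfolding linear_piece_def by blast
  have ends: "\<delta> ((l + c) / 2) = \<gamma> l" "\<delta> ((r + c) / 2) = \<gamma> r"
    using eq[of "(l + c) / 2"] eq[of "(r + c) / 2"] \<open>l < r\<close> by (auto simp: field_simps)
  have rng: "2 * s - c \<in> {l..r}" if "s \<in> {(l + c) / 2..(r + c) / 2}" for s
    using that by auto
  have img: "\<delta> ` {(l + c) / 2..(r + c) / 2} \<subseteq> U"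
  proof clarify
    fix s assume "s \<in> {(l + c) / 2..(r + c) / 2}"
    then show "\<delta> s \<in> U" using rng[of s] eq[of s] U(2) by auto
  qed
  have lin: "\<psi> (\<delta> s) = \<psi> (\<delta> ((l + c) / 2)) + ((s - (l + c) / 2) / ((r + c) / 2 - (l + c) / 2)) *\<^sub>R
      (\<psi> (\<delta> ((r + c) / 2)) - \<psi> (\<delta> ((l + c) / 2)))" if s: "s \<in> {(l + c) / 2..(r + c) / 2}" for s
  proof -
    have "(s - (l + c) / 2) / ((r + c) / 2 - (l + c) / 2) = (2 * s - c - l) / (r - l)"
      using \<open>l < r\<close> by (simp add: divide_simps) (simp add: algebra_simps)
    then show ?thesis unfolding ends using U(3)[OF rng[OF s]] eq[of s] rng[OF s] by simp
  qed
  show ?thesis unfolding linear_piece_def using U(1) img lin by blast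
qed

lemma partition_mono:
  fixes t :: "nat \<Rightarrow> real"
  assumes "\<forall>i<k. t i < t (Suc i)" "i \<le> j" "j \<le> k"
  shows "t i \<le> t j"
  using assms(2,3)
proof (induction j rule: dec_induct)
  case (step n)
  then show ?case using assms(1) by (meson Suc_le_lessD less_imp_le order_trans)
qed simp

lemma broken_line_join:
  assumes "broken_line A \<gamma>1" "broken_line A \<gamma>2" "\<gamma>1 1 = \<gamma>2 0"
  shows "broken_line A (\<gamma>1 +++ \<gamma>2)"
proof -
  let ?\<gamma> = "\<gamma>1 +++ \<gamma>2"
  obtain k1 t1 where 1: "continuous_on {0..1} \<gamma>1" "k1 \<ge> 1" "t1 0 = 0" "t1 k1 = 1"
    "\<forall>i<k1. t1 i < t1 (Suc i)" "\<And>i. i < k1 \<Longrightarrow> linear_piece A \<gamma>1 (t1 i) (t1 (Suc i))"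
    using assms(1) unfolding broken_line_iff by blast
  obtain k2 t2 where 2: "continuous_on {0..1} \<gamma>2" "k2 \<ge> 1" "t2 0 = 0" "t2 k2 = 1"
    "\<forall>i<k2. t2 i < t2 (Suc i)" "\<And>i. i < k2 \<Longrightarrow> linear_piece A \<gamma>2 (t2 i) (t2 (Suc i))"
    using assms(2) unfolding broken_line_iff by blast
  \<comment> \<open>The two partitions share the index \<open>k1\<close>: the end of the first and
    the start of the second both become 1/2, so the formula for the right half also holds at
    \<open>j = 0\<close>.\<close>
  define t where "t = (\<lambda>i. if i \<le> k1 then t1 i / 2 else (t2 (i - k1) + 1) / 2)"
  have t_right: "t (k1 + j) = (t2 j + 1) / 2" for j
    using 1(4) 2(3) by (auto simp: t_def)
  have "continuous_on {0..1} ?\<gamma>"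
    using 1(1) 2(1) assms(3) by (intro continuous_on_joinpaths) (auto simp: pathfinish_def pathstart_def)
  moreover have "k1 + k2 \<ge> 1" "t 0 = 0" "t (k1 + k2) = 1"
    using 1 2 by (auto simp: t_right) (simp add: t_def)
  moreover have "t i < t (Suc i) \<and> linear_piece A ?\<gamma> (t i) (t (Suc i))" if "i < k1 + k2" for i
  proof (cases "i < k1")
    case True
    then have ti: "t i = (t1 i + 0) / 2" "t (Suc i) = (t1 (Suc i) + 0) / 2" by (auto simp: t_def)
    have lt: "t1 i < t1 (Suc i)" "t1 (Suc i) \<le> 1"
      using 1(4,5) True partition_mono[of k1 t1 "Suc i" k1] by auto
    then show ?thesis
      unfolding ti using 1(6)[OF True]
      by (auto intro!: linear_piece_reparam[where c = 0, simplified] simp: joinpaths_def)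
  next
    case False
    define j where "j = i - k1"
    have j: "i = k1 + j" "Suc i = k1 + Suc j" "j < k2" using False that by (auto simp: j_def)
    have ti: "t i = (t2 j + 1) / 2" "t (Suc i) = (t2 (Suc j) + 1) / 2"
      using t_right[of j] t_right[of "Suc j"] j by simp_all
    have lt: "t2 j < t2 (Suc j)" "0 \<le> t2 j"
      using 2(3,5) j(3) partition_mono[of k2 t2 0 j] by auto
    \<comment> \<open>At \<open>s = 1/2\<close> the joined path is defined through
      \<open>\<gamma>1\<close>, so the agreement of the endpoints is needed there.\<close>
    have "?\<gamma> s = \<gamma>2 (2 * s - 1)" if "t2 j \<le> 2 * s - 1" for s
    proof (cases "s = 1/2")
      case True
      show ?thesis unfolding True using assms(3) by (simp add: joinpaths_def)
    next
      case False
      then show ?thesis using that lt by (simp add: joinpaths_def)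
    qed
    then show ?thesis
      unfolding ti using lt 2(6)[OF j(3)] by (auto intro!: linear_piece_reparam)
  qed
  ultimately show ?thesis unfolding broken_line_iff by blast
qed

lemma broken_line_segment:
  assumes A: "smooth_atlas A" "(U, \<psi>) \<in> A" and seg: "closed_segment x y \<subseteq> \<psi> ` U"
  shows "broken_line A (\<lambda>s. inv_into U \<psi> (x + s *\<^sub>R (y - x)))"
proof -
  let ?g = "inv_into U \<psi>"
  note ch = chart_facts[OF A]
  have mem: "x + s *\<^sub>R (y - x) \<in> \<psi> ` U" if "0 \<le> s" "s \<le> 1" for s
    using seg that by (force simp: in_segment algebra_simps)
  have "continuous_on {0..1} (\<lambda>s. ?g (x + s *\<^sub>R (y - x)))"
    using mem by (intro continuous_on_compose2[OF ch(5)] continuous_intros) auto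
  moreover have "linear_piece A (\<lambda>s. ?g (x + s *\<^sub>R (y - x))) 0 1"
    unfolding linear_piece_def
  proof (rule bexI[OF _ A(2)], safe)
    fix s :: real assume s: "s \<in> {0..1}"
    show "?g (x + s *\<^sub>R (y - x)) \<in> U" using mem[of s] s by (auto intro!: inv_into_into)
    show "\<psi> (?g (x + s *\<^sub>R (y - x))) = \<psi> (?g (x + 0 *\<^sub>R (y - x))) + ((s - 0) / (1 - 0)) *\<^sub>R
        (\<psi> (?g (x + 1 *\<^sub>R (y - x))) - \<psi> (?g (x + 0 *\<^sub>R (y - x))))"
      using f_inv_into_f[OF mem[of s]] f_inv_into_f[OF mem[of 0]] f_inv_into_f[OF mem[of 1]] s by simp
  qed
  ultimately show ?thesis
    unfolding broken_line_iff by (intro conjI exI[of _ "1::nat"] exI[of _ real]) auto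
qed

section \<open>Joining points off the singular set\<close>

text \<open>Only interior times must avoid \<open>Z\<close>, since the given endpoints may
  themselves be singular. Concatenation therefore requires the intermediate point to lie outside
  \<open>Z\<close>.\<close>

definition joined_off ::
  "('a::topological_space set \<times> ('a \<Rightarrow> real^'n)) set \<Rightarrow> 'a set \<Rightarrow> 'a \<Rightarrow> 'a \<Rightarrow> bool" where
  "joined_off A Z a b \<longleftrightarrow> (\<exists>\<gamma>. broken_line A \<gamma> \<and> \<gamma> 0 = a \<and> \<gamma> 1 = b \<and> (\<forall>s\<in>{0<..<1}. \<gamma> s \<notin> Z))"

lemma joined_off_trans:
  assumes "joined_off A Z a g" "joined_off A Z g b" "g \<notin> Z"
  shows "joined_off A Z a b"
proof -
  obtain \<gamma>1 where 1: "broken_line A \<gamma>1" "\<gamma>1 0 = a" "\<gamma>1 1 = g" "\<forall>s\<in>{0<..<1}. \<gamma>1 s \<notin> Z"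
    using assms(1) unfolding joined_off_def by blast
  obtain \<gamma>2 where 2: "broken_line A \<gamma>2" "\<gamma>2 0 = g" "\<gamma>2 1 = b" "\<forall>s\<in>{0<..<1}. \<gamma>2 s \<notin> Z"
    using assms(2) unfolding joined_off_def by blast
  have "(\<gamma>1 +++ \<gamma>2) s \<notin> Z" if "s \<in> {0<..<1}" for s
  proof -
    consider "s < 1/2" | (half) "s = 1/2" | "s > 1/2" by linarith
    then show ?thesis
    proof cases
      case half
      show ?thesis unfolding half using \<open>\<gamma>1 1 = g\<close> assms(3) by (simp add: joinpaths_def)
    qed (use that 1(4) 2(4) in \<open>auto simp: joinpaths_def\<close>)
  qed
  moreover have "broken_line A (\<gamma>1 +++ \<gamma>2)" using 1 2 by (intro broken_line_join) auto
  moreover have "(\<gamma>1 +++ \<gamma>2) 0 = a" "(\<gamma>1 +++ \<gamma>2) 1 = b" using 1 2 by (auto simp: joinpaths_def)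
  ultimately show ?thesis unfolding joined_off_def by blast
qed

lemma open_minus_negligible_ne:
  fixes W :: "'a::euclidean_space set"
  assumes "open W" "W \<noteq> {}" "negligible N"
  obtains c where "c \<in> W" "c \<notin> N"
  using assms open_not_negligible negligible_subset by blast

text \<open>In a chart ball, a point \<open>c\<close> outside the null cones with apexes at the
  images of \<open>a\<close> and \<open>b\<close> sees both along segments that avoid the singular
  set. The cone contains the singular set itself, at scale 1, so nonsingular points are
  dense.\<close>

lemma good_neighbourhood:
  fixes A :: "('a::topological_space set \<times> ('a \<Rightarrow> real^'n)) set"
  assumes A: "smooth_atlas A" and scl: "SCL A \<phi>"
  obtains N where "open N" "x \<in> N" "\<And>a b. a \<in> N \<Longrightarrow> b \<in> N \<Longrightarrow> joined_off A (Sigma_ge2 A \<phi>) a b"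
    "\<And>W. open W \<Longrightarrow> W \<subseteq> N \<Longrightarrow> W \<noteq> {} \<Longrightarrow> \<exists>g\<in>W. g \<notin> Sigma_ge2 A \<phi>"
proof -
  obtain U \<psi> where U: "(U, \<psi>) \<in> A" "x \<in> U"
  proof -
    have "x \<in> \<Union>(fst ` A)" using A unfolding smooth_atlas_def by blast
    then show thesis using that by auto
  qed
  note ch = chart_facts[OF A U(1)]
  let ?g = "inv_into U \<psi>" and ?Z = "Sigma_ge2 A \<phi>"
  define u where "u = \<phi> \<circ> ?g"
  have "loc_semiconcave_lin (\<psi> ` U) u" using scl U(1) unfolding SCL_def u_def by blast
  moreover have "\<psi> x \<in> \<psi> ` U" using U by blast
  ultimately obtain r C where rC: "r > 0" "C \<ge> 0" "ball (\<psi> x) r \<subseteq> \<psi> ` U"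
    "\<And>w. w \<in> ball (\<psi> x) r \<Longrightarrow> \<exists>p. \<forall>y\<in>ball (\<psi> x) r. u y \<le> u w + p \<bullet> (y - w) + C / 2 * (norm (y - w))\<^sup>2"
    unfolding loc_semiconcave_lin_def by blast
  let ?B = "ball (\<psi> x) r"
  define bad where "bad = (\<lambda>a. {a + s *\<^sub>R (y - a) | s y. y \<in> ?B \<and> aff_dim (superdiff (\<psi> ` U) u y) \<ge> 2})"
  have neg: "negligible (bad a)" for a
    unfolding bad_def using negligible_cone_singular[OF rC(3,2,4)] by blast
  \<comment> \<open>If the point \<open>y\<close> at time \<open>s\<close> were singular, then
    \<open>c = a + (1 / s) (y - a)\<close> would lie in the cone with apex \<open>a\<close>.
    Admitting \<open>s = 1\<close> makes \<open>c\<close> itself nonsingular.\<close>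
  have off: "?g (a + s *\<^sub>R (c - a)) \<notin> ?Z"
    if c: "c \<in> ?B" "c \<notin> bad a" and a: "a \<in> ?B" and s: "0 < s" "s \<le> 1" for a c s
  proof
    define y where "y = a + s *\<^sub>R (c - a)"
    assume Z: "?g (a + s *\<^sub>R (c - a)) \<in> ?Z"
    have yB: "y \<in> ?B"
      using convexD_alt[OF convex_ball a c(1), of s] s by (simp add: y_def algebra_simps)
    then have yU: "y \<in> \<psi> ` U" using rC(3) by blast
    then have "aff_dim (superdiff (\<psi> ` U) u (\<psi> (?g y))) \<ge> 2"
      unfolding u_def using Sigma_ge2_chart[OF A U(1) inv_into_into[OF yU]] Z by (simp add: y_def)
    then have "aff_dim (superdiff (\<psi> ` U) u y) \<ge> 2" by (simp add: f_inv_into_f[OF yU])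
    moreover have "c = a + (1 / s) *\<^sub>R (y - a)" using s by (simp add: y_def)
    ultimately have "c \<in> bad a" using yB unfolding bad_def by blast
    then show False using c by simp
  qed
  define N where "N = U \<inter> \<psi> -` ?B"
  have gN: "?g (\<psi> a) = a" "\<psi> a \<in> ?B" if "a \<in> N" for a
    using that ch(4) by (auto simp: N_def)
  show ?thesis
  proof
    show "open N" unfolding N_def by (rule continuous_open_preimage[OF ch(3,1)]) simp
    show "x \<in> N" using U rC(1) by (simp add: N_def)
  next
    fix a b assume ab: "a \<in> N" "b \<in> N"
    have "negligible (bad (\<psi> a) \<union> bad (\<psi> b))" using neg by simp
    then obtain c where c: "c \<in> ?B" "c \<notin> bad (\<psi> a)" "c \<notin> bad (\<psi> b)"
      using open_minus_negligible_ne[of ?B] rC(1) by (metis UnCI centre_in_ball empty_iff open_ball)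
    have seg: "closed_segment p q \<subseteq> \<psi> ` U" if "p \<in> ?B" "q \<in> ?B" for p q
      using that rC(3) closed_segment_subset[OF _ _ convex_ball, of p "\<psi> x" r q] by blast
    have "joined_off A ?Z a (?g c)"
      unfolding joined_off_def
      using broken_line_segment[OF A U(1) seg, of "\<psi> a" c] off[OF c(1,2) gN(2)[OF ab(1)]] c gN ab
      by (intro exI[of _ "\<lambda>s. ?g (\<psi> a + s *\<^sub>R (c - \<psi> a))"]) auto
    moreover have "joined_off A ?Z (?g c) b"
      unfolding joined_off_def
    proof (intro exI conjI ballI)
      show "broken_line A (\<lambda>s. ?g (c + s *\<^sub>R (\<psi> b - c)))"
        using broken_line_segment[OF A U(1) seg] c gN ab by blast
      show "?g (c + 0 *\<^sub>R (\<psi> b - c)) = ?g c" "?g (c + 1 *\<^sub>R (\<psi> b - c)) = b" using gN ab by auto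
      fix s :: real assume s: "s \<in> {0<..<1}"
      \<comment> \<open>The second segment is read backwards from \<open>b\<close>, because the cone
        that \<open>c\<close> avoids has its apex there.\<close>
      have "c + s *\<^sub>R (\<psi> b - c) = \<psi> b + (1 - s) *\<^sub>R (c - \<psi> b)" by (simp add: algebra_simps)
      then show "?g (c + s *\<^sub>R (\<psi> b - c)) \<notin> ?Z"
        using off[OF c(1,3) gN(2)[OF ab(2)], of "1 - s"] s by simp
    qed
    moreover have "?g c \<notin> ?Z" using off[OF c(1,2) gN(2)[OF ab(1)], of 1] by simp
    ultimately show "joined_off A ?Z a b" by (rule joined_off_trans)
  next
    fix W assume W: "open W" "W \<subseteq> N" "W \<noteq> {}"
    have "open (\<psi> ` W)" using chart_open_image[OF A U(1) W(1)] W(2) by (auto simp: N_def)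
    then obtain c where c: "c \<in> \<psi> ` W" "c \<notin> bad (\<psi> x)"
      using open_minus_negligible_ne[OF _ _ neg] W(3) by blast
    then obtain w where w: "w \<in> W" "c = \<psi> w" by blast
    then have "?g (\<psi> x + 1 *\<^sub>R (c - \<psi> x)) \<notin> ?Z"
      using off[of c "\<psi> x" 1] c gN W rC(1) by auto
    then show "\<exists>g\<in>W. g \<notin> ?Z" using w gN W by auto
  qed
qed

theorem theorem3:
  fixes A :: "('a::t2_space set \<times> ('a \<Rightarrow> real^'n)) set"
    and \<phi> :: "'a \<Rightarrow> real"
  assumes "compact (UNIV :: 'a set)" and "connected (UNIV :: 'a set)"
    and "smooth_atlas A"
    and "CARD('n) \<ge> 2"
    and "SCL A \<phi>"
    and "a \<noteq> b"
  shows "\<exists>\<gamma>. broken_line A \<gamma> \<and> \<gamma> 0 = a \<and> \<gamma> 1 = b \<and>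
           (\<forall>s\<in>{0<..<1}. \<gamma> s \<notin> Sigma_ge2 A \<phi>)"
proof -
  let ?Z = "Sigma_ge2 A \<phi>"
  have "\<exists>N. open N \<and> x \<in> N \<and> (\<forall>a\<in>N. \<forall>b\<in>N. joined_off A ?Z a b) \<and>
      (\<forall>W. open W \<longrightarrow> W \<subseteq> N \<longrightarrow> W \<noteq> {} \<longrightarrow> (\<exists>g\<in>W. g \<notin> ?Z))" for x
    using good_neighbourhood[OF assms(3,5), of x] by metis
  then obtain N where N: "\<And>x. open (N x)" "\<And>x. x \<in> N x"
    "\<And>x a b. a \<in> N x \<Longrightarrow> b \<in> N x \<Longrightarrow> joined_off A ?Z a b"
    "\<And>x W. open W \<Longrightarrow> W \<subseteq> N x \<Longrightarrow> W \<noteq> {} \<Longrightarrow> \<exists>g\<in>W. g \<notin> ?Z"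
    by metis
  \<comment> \<open>\<open>R\<close> is the interior of the set of points reachable from
    \<open>a\<close>. It is open by construction, and the rest shows that its complement is open
    too.\<close>
  define R where "R = \<Union>{W. open W \<and> (\<forall>y\<in>W. joined_off A ?Z a y)}"
  have "open R" unfolding R_def by blast
  have "a \<in> R" unfolding R_def using N(1-3)[of a] by blast
  have "N x \<subseteq> R" if ne: "N x \<inter> R \<noteq> {}" for x
  proof -
    \<comment> \<open>The overlap is a nonempty open part of \<open>N x\<close>, so it contains a
      nonsingular point, at which a path from \<open>a\<close> can be glued to a local path.\<close>
    obtain g where g: "g \<in> N x \<inter> R" "g \<notin> ?Z"
      using N(4)[of "N x \<inter> R" x] N(1) \<open>open R\<close> ne by blast
    have "joined_off A ?Z a g" using g unfolding R_def by blast
    then have "joined_off A ?Z a y" if "y \<in> N x" for y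
      using joined_off_trans[OF _ N(3)[of g x y] g(2)] g that by blast
    then show ?thesis unfolding R_def using N(1) by blast
  qed
  \<comment> \<open>A neighbourhood \<open>N x\<close> that meets \<open>R\<close> lies inside
    \<open>R\<close>, so for \<open>x\<close> outside \<open>R\<close> it lies entirely in the
    complement.\<close>
  then have "- R = (\<Union>x\<in>- R. N x)" using N(2) by blast
  then have "open (- R)" using open_UN[of "- R" N] N(1) by simp
  then have "- R = {}"
    using connectedD[OF assms(2) \<open>open R\<close>, of "- R"] \<open>a \<in> R\<close> by blast
  then show ?thesis unfolding R_def joined_off_def by blast
qed

end
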